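(* Let $k \ge 1$ be an integer. In every $k$-game (that is, for every card number $m \ge k$ and every initial deal of $k$ nonempty stacks chosen by the demon), the player (called Atticus) has a winning strategy against König's Demon.
   Context: The solitaire game. Fix an integer $k\ge 1$ (the game number). The demon chooses an integer $m\ge k$ (the card number) and takes a deck consisting of exactly $k$ cards of each type $1,2,\dots,m$ (a card of type $a$ is called an $a$-card). The demon deals $k$ nonempty stacks from the deck, numbered $1,\dots,k$, such that each stack contains at most one card of each type; the number of cards $n_i\ge 1$ in stack $i$ is up to the demon, and $(n_1,\dots,n_k)$ is called the stack profile. The remaining cards of the deck form the reserve. All cards (stacks and reserve) are visible. Thus a position amounts to a $k$-tuple $(S_1,\dots,S_k)$ of nonempty subsets of $\{1,\dots,m\}$, where $S_i$ is the set of types in stack $i$; since there are $k$ cards of each type, whenever some stack has no $b$-card the reserve contains a $b$-card. Such a game is called a $k$-game. Play proceeds in turns. At the start of a turn the player wins if she can make a hand of $k$ differently numbered cards by picking one card from each stack (i.e. there are pairwise distinct $c_1,\dots,c_k$ with $c_i\in S_i$ for all $i$); this includes the start of the first turn. Otherwise the player makes a move: she picks some stack $i$ containing an $a$-card but no $b$-card and swaps the $a$-card for a $b$-card from the reserve (so $S_i$ is replaced by $(S_i\setminus\{a\})\cup\{b\}$). Then the demon responds, and the next turn begins. König's Demon: if the player has just swapped an $a$-card out of and a $b$-card into the $i$-th stack, the demon either does nothing, or picks one stack other than the $i$-th which contains a $b$-card but no $a$-card and swaps that $b$-card for an $a$-card from the reserve. A winning strategy for the player against a given demon is a way of choosing moves,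 depending on the play so far, that guarantees that the player wins after finitely many turns, whatever responses permitted to that demon are chosen. *)

theory Defs
  imports Main
begin

text \<open>
  A position is a tuple of stacks, given by \<open>S i\<close>, the set of card types in stack \<open>i\<close>, for
  \<open>i \<in> {1..k}\<close>; the values of \<open>S\<close> at other indices play no role. Since no stack has two cards
  of one type and the deck has \<open>k\<close> cards of each type, the reserve is determined by the stacks,
  and it contains a \<open>b\<close>-card whenever some stack has none.
\<close>

type_synonym position = "nat \<Rightarrow> nat set"

text \<open>\<open>(i, a, b)\<close>: in stack \<open>i\<close>, an \<open>a\<close>-card is swapped for a \<open>b\<close>-card from the reserve.\<close>

type_synonym move = "nat \<times> nat \<times> nat"

definition is_deal :: "nat \<Rightarrow> nat \<Rightarrow> position \<Rightarrow> bool" where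
  "is_deal k m S \<longleftrightarrow> (\<forall>i\<in>{1..k}. S i \<noteq> {} \<and> S i \<subseteq> {1..m})"

definition has_hand :: "nat \<Rightarrow> position \<Rightarrow> bool" where
  "has_hand k S \<longleftrightarrow> (\<exists>c. inj_on c {1..k} \<and> (\<forall>i\<in>{1..k}. c i \<in> S i))"

fun legal_move :: "nat \<Rightarrow> nat \<Rightarrow> position \<Rightarrow> move \<Rightarrow> bool" where
  "legal_move k m S (i, a, b) \<longleftrightarrow> i \<in> {1..k} \<and> a \<in> S i \<and> b \<in> {1..m} \<and> b \<notin> S i"

fun make_move :: "position \<Rightarrow> move \<Rightarrow> position" where
  "make_move S (i, a, b) = S(i := (S i - {a}) \<union> {b})"

text \<open>
  A demon maps the player's move and the position resulting from it to the set of positions in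
  which it may leave the game.
\<close>

type_synonym demon = "move \<Rightarrow> position \<Rightarrow> position set"

fun konig_demon :: "nat \<Rightarrow> demon" where
  "konig_demon k (i, a, b) S =
     {S} \<union> {make_move S (j, b, a) | j. j \<in> {1..k} \<and> j \<noteq> i \<and> b \<in> S j \<and> a \<notin> S j}"

text \<open>
  A strategy chooses a move from the list of the positions at the start of all turns so far, the
  current position last. The player's own earlier moves, and hence the demon's responses, can be
  reconstructed from this list and the strategy.
\<close>

type_synonym strategy = "position list \<Rightarrow> move"

text \<open>
  The finite initial segments of plays in which the player follows \<open>\<sigma>\<close> from the deal \<open>S\<close>. A
  play is not continued once the player has won.
\<close>

inductive play_prefix :: "nat \<Rightarrow> demon \<Rightarrow> position \<Rightarrow> strategy \<Rightarrow> position list \<Rightarrow> bool"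
  for k :: nat and D :: demon and S :: position and \<sigma> :: strategy where
  deal: "play_prefix k D S \<sigma> [S]"
| turn: "play_prefix k D S \<sigma> h \<Longrightarrow> \<not> has_hand k (last h)
    \<Longrightarrow> T \<in> D (\<sigma> h) (make_move (last h) (\<sigma> h)) \<Longrightarrow> play_prefix k D S \<sigma> (h @ [T])"

text \<open>
  The strategy must supply a legal move at every turn that does not start with a win, and no play
  may go on forever. As Koenig's demon always has a permitted response, a play can then only end
  with a win.
\<close>

definition winning_strategy :: "nat \<Rightarrow> nat \<Rightarrow> demon \<Rightarrow> position \<Rightarrow> strategy \<Rightarrow> bool" where
  "winning_strategy k m D S \<sigma> \<longleftrightarrow>
     (\<forall>h. play_prefix k D S \<sigma> h \<longrightarrow> \<not> has_hand k (last h) \<longrightarrow> legal_move k m (last h) (\<sigma> h)) \<and>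
     \<not> (\<exists>P :: nat \<Rightarrow> position. \<forall>n. play_prefix k D S \<sigma> (map P [0..<Suc n]))"

end

theory Submission
  imports Defs
begin

text \<open>
  The player enlarges a partial hand by one card per turn. Suppose that the best partial hand takes
  its cards from a set of stacks that misses stack \<open>i\<close>. It uses fewer than \<open>k \<le> m\<close> types, so some
  type \<open>b\<close> is not used in it, and stack \<open>i\<close> has no \<open>b\<close>-card, for that card would extend the hand.
  The player swaps any card of stack \<open>i\<close> for a \<open>b\<close>-card. Koenig's demon may only remove a
  \<open>b\<close>-card from some other stack, and no \<open>b\<close>-card of another stack belongs to the partial hand.
  So the partial hand survives his response, and the new \<open>b\<close>-card of stack \<open>i\<close> extends it
  (lemma \<open>konig_demon_progress\<close>). After at most \<open>k\<close> turns the hand is complete.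

  The name of the demon comes from edge colouring. Let stack \<open>i\<close> be the set of colours missing at
  the \<open>i\<close>-th neighbour of a vertex whose edges are still uncoloured. A move switches the two colours
  on the alternating path that starts at this neighbour, and the response records what happens at
  the other end of the path. In a bipartite graph, if that end is again a neighbour of the vertex,
  then by parity the path has even length, and this end loses exactly the missing colour that the
  start gains. So the argument above is also a proof of Koenig's edge colouring theorem.
\<close>

section \<open>Strategies from a decreasing measure\<close>

text \<open>
  A winning strategy only has to improve the current position, whatever happened before: for any
  demon, it suffices to have a measure that some legal move decreases against all responses.
\<close>

lemma winning_strategy_of_measure:
  fixes \<mu> :: "position \<Rightarrow> nat"
  assumes start: "I S"
    and progress: "\<And>S. \<lbrakk>I S; \<not> has_hand k S\<rbrakk> \<Longrightarrow>
      \<exists>mv. legal_move k m S mv \<and> (\<forall>T\<in>D mv (make_move S mv). I T \<and> \<mu> T < \<mu> S)"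
  shows "\<exists>\<sigma>. winning_strategy k m D S \<sigma>"
proof -
  obtain f where f: "\<And>S. \<lbrakk>I S; \<not> has_hand k S\<rbrakk> \<Longrightarrow>
      legal_move k m S (f S) \<and> (\<forall>T\<in>D (f S) (make_move S (f S)). I T \<and> \<mu> T < \<mu> S)"
    using progress by metis
  define \<sigma> where "\<sigma> = (\<lambda>h. f (last h))"
  have inv: "I (last h)" if "play_prefix k D S \<sigma> h" for h
    using that by induction (use start f in \<open>auto simp: \<sigma>_def\<close>)
  have "False" if P: "\<And>n. play_prefix k D S \<sigma> (map P [0..<Suc n])" for P
  proof -
    have "\<mu> (P (Suc n)) < \<mu> (P n)" for n
    proof -
      have "I (P n)"
        using inv[OF P[of n]] by simp
      from P[of "Suc n"] show ?thesis
      proof cases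
        case deal
        then show ?thesis by simp
      next
        case (turn h T)
        then have "h = map P [0..<Suc n]" "T = P (Suc n)"
          by auto
        then show ?thesis
          using turn f[OF \<open>I (P n)\<close>] by (auto simp: \<sigma>_def)
      qed
    qed
    then have "\<exists>Q :: nat \<Rightarrow> nat. \<forall>n. (Q (Suc n), Q n) \<in> less_than"
      by (intro exI[of _ "\<lambda>n. \<mu> (P n)"]) auto
    then show False
      using wf_less_than unfolding wf_iff_no_infinite_down_chain by blast
  qed
  then have "winning_strategy k m D S \<sigma>"
    unfolding winning_strategy_def using inv f by (metis \<sigma>_def)
  then show ?thesis
    by blast
qed

section \<open>Partial hands\<close>

definition partial_hand :: "position \<Rightarrow> nat set \<Rightarrow> (nat \<Rightarrow> nat) \<Rightarrow> bool" where
  "partial_hand S J c \<longleftrightarrow> inj_on c J \<and> (\<forall>i\<in>J. c i \<in> S i)"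

definition max_hand_size :: "nat \<Rightarrow> position \<Rightarrow> nat" where
  "max_hand_size k S = Max (card ` {J. J \<subseteq> {1..k} \<and> (\<exists>c. partial_hand S J c)})"

lemma finite_hand_sizes: "finite (card ` {J. J \<subseteq> {1..k} \<and> (\<exists>c. partial_hand S J c)})"
  by (rule finite_imageI, rule finite_subset[of _ "Pow {1..k}"]) auto

lemma max_hand_size_ge:
  "\<lbrakk>J \<subseteq> {1..k}; partial_hand S J c\<rbrakk> \<Longrightarrow> card J \<le> max_hand_size k S"
  unfolding max_hand_size_def by (intro Max_ge finite_hand_sizes) auto

lemma max_hand_size_attained:
  obtains J c where "J \<subseteq> {1..k}" "partial_hand S J c" "card J = max_hand_size k S"
proof -
  have "partial_hand S {} c" for c
    by (simp add: partial_hand_def)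
  then have "card ` {J. J \<subseteq> {1..k} \<and> (\<exists>c. partial_hand S J c)} \<noteq> {}"
    by blast
  from Max_in[OF finite_hand_sizes this] show thesis
    using that unfolding max_hand_size_def[symmetric] by auto
qed

lemma max_hand_size_le: "max_hand_size k S \<le> k"
proof -
  obtain J c where "J \<subseteq> {1..k}" "card J = max_hand_size k S"
    by (rule max_hand_size_attained)
  then show ?thesis
    using card_mono[of "{1..k}" J] by simp
qed

lemma partial_hand_insert:
  assumes "partial_hand S J c" "i \<notin> J" "b \<notin> c ` J"
    and "b \<in> T i" "\<And>j. j \<in> J \<Longrightarrow> c j \<in> S j \<Longrightarrow> c j \<in> T j"
  shows "partial_hand T (insert i J) (c(i := b))"
  using assms unfolding partial_hand_def by (auto simp: inj_on_def)

section \<open>Playing against Koenig's demon\<close>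

lemma is_deal_make_move:
  "\<lbrakk>is_deal k m S; b \<in> {1..m}\<rbrakk> \<Longrightarrow> is_deal k m (make_move S (i, a, b))"
  unfolding is_deal_def by auto

text \<open>
  The move fetches a type \<open>b\<close> that the largest partial hand does not use. The demon can remove
  only cards of that type, so the fetched card is a net gain.
\<close>

lemma konig_demon_progress:
  assumes "m \<ge> k" and deal: "is_deal k m S" and "\<not> has_hand k S"
  shows "\<exists>mv. legal_move k m S mv \<and> (\<forall>T\<in>konig_demon k mv (make_move S mv).
    is_deal k m T \<and> max_hand_size k S < max_hand_size k T)"
proof -
  obtain J c where J: "J \<subseteq> {1..k}" and c: "partial_hand S J c"
    and max: "card J = max_hand_size k S"
    by (rule max_hand_size_attained)
  have "finite J"
    using J finite_subset by blast
  have "J \<noteq> {1..k}"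
    using c \<open>\<not> has_hand k S\<close> by (auto simp: partial_hand_def has_hand_def)
  then obtain i where i: "i \<in> {1..k}" "i \<notin> J"
    using J by blast
  have larger: "max_hand_size k S < max_hand_size k T"
    if "partial_hand T (insert i J) d" for T d
  proof -
    have "insert i J \<subseteq> {1..k}"
      using J i by blast
    from max_hand_size_ge[OF this that] show ?thesis
      using i max \<open>finite J\<close> by simp
  qed
  have "card J < k"
    using psubset_card_mono[of "{1..k}" J] J \<open>J \<noteq> {1..k}\<close> by auto
  then have "card (c ` J) < card {1..m}"
    using card_image_le[OF \<open>finite J\<close>, of c] \<open>m \<ge> k\<close> by simp
  then obtain b where b: "b \<in> {1..m}" "b \<notin> c ` J"
    using \<open>finite J\<close> by (meson card_mono finite_imageI not_le subsetI)
  have "b \<notin> S i"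
    using larger[OF partial_hand_insert[OF c i(2) b(2)]] by auto
  obtain a where a: "a \<in> S i" "a \<in> {1..m}"
    using deal i(1) unfolding is_deal_def by blast
  let ?U = "make_move S (i, a, b)"
  have U: "is_deal k m ?U"
    by (rule is_deal_make_move[OF deal b(1)])
  have "is_deal k m T \<and> max_hand_size k S < max_hand_size k T"
    if response: "T \<in> konig_demon k (i, a, b) ?U" for T
  proof -
    consider "T = ?U" | j where "j \<noteq> i" "T = make_move ?U (j, b, a)"
      using response by auto
    then have "is_deal k m T \<and> b \<in> T i \<and> (\<forall>j\<in>J. c j \<in> S j \<longrightarrow> c j \<in> T j)"
    proof cases
      case 1
      then show ?thesis
        using U i b by auto
    next
      case 2
      then have "is_deal k m T"
        using is_deal_make_move[OF U a(2)] by (simp only:)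
      then show ?thesis
        using 2 i b by auto
    qed
    then show ?thesis
      using larger partial_hand_insert[OF c i(2) b(2)] by blast
  qed
  moreover have "legal_move k m S (i, a, b)"
    using i a b \<open>b \<notin> S i\<close> by simp
  ultimately show ?thesis
    by blast
qed

theorem theorem1:
  fixes k m :: nat and S :: position
  assumes "k \<ge> 1" and "m \<ge> k" and "is_deal k m S"
  shows "\<exists>\<sigma>. winning_strategy k m (konig_demon k) S \<sigma>"
proof (rule winning_strategy_of_measure[where I = "is_deal k m"
      and \<mu> = "\<lambda>S. k - max_hand_size k S"])
  show "is_deal k m S"
    by fact
next
  fix S
  assume "is_deal k m S" "\<not> has_hand k S"
  from konig_demon_progress[OF \<open>m \<ge> k\<close> this]
  show "\<exists>mv. legal_move k m S mv \<and> (\<forall>T\<in>konig_demon k mv (make_move S mv).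
      is_deal k m T \<and> k - max_hand_size k T < k - max_hand_size k S)"
    using max_hand_size_le by (meson diff_less_mono2 less_le_trans)
qed

end
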